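(* There are constants $c_r$ (one for each positive integer $r$, depending only on $r$), satisfying $c_r\to\frac{e}{e-1}$ as $r\to\infty$, and absolute constants $K,m>0$, such that the following holds for all positive integers $t,d,r$. Given $N$ color classes of $r$ points each in $\mathbb{R}^d$, where $N$ is an integer with \[ N\ge c_r t+K\left(r\sqrt{td}+rd\right)\left(\ln(2+t+d+r)\right)^m , \] there is a colorful partition of them into $r$ sets $A_1,\ldots,A_r$ such that, even if we remove any $t$ color classes, the convex hulls of what is left in each $A_i$ still intersect, i.e. the $r$ convex hulls have a common point.
   Context: Given families of $r$ points each, considered as color classes, a colorful partition is a partition of their union into $r$ sets $A_1,\ldots,A_r$ such that each $A_i$ has exactly one point of each color class. Points belonging to different color classes are regarded as different (labelled) points. The paper states the number of classes as $c_rt+\tilde O(r\sqrt{td}+rd)$, where $\tilde O(\cdot)$ hides an absolute constant and only polylogarithmic factors in $r,t,d$; the claim writes this out explicitly. *)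

theory Defs
  imports "HOL-Analysis.Analysis" "HOL-Analysis.Finite_Function_Topology"
begin

text \<open>
  The dimension has to be quantified inside the statement, after the absolute constants, so
  d-dimensional real space is a subspace of the real vector space of finitely supported
  sequences, where the library's convex hull is available.  The lemma below identifies it
  with the point set of the library's Euclidean space of dimension d.
\<close>

definition Rn :: "nat \<Rightarrow> (nat \<Rightarrow>\<^sub>0 real) set"
  where "Rn d = {x. Poly_Mapping.keys x \<subseteq> {..<d}}"

lemma lookup_Rn: "bij_betw Poly_Mapping.lookup (Rn d) (topspace (Euclidean_space d))"
proof -
  have "f \<in> Poly_Mapping.lookup ` Rn d" if "\<forall>i\<ge>d. f i = 0" for f :: "nat \<Rightarrow> real"
  proof -
    have sub: "{i. f i \<noteq> 0} \<subseteq> {..<d}"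
      using that not_less by blast
    then have "finite {i. f i \<noteq> 0}"
      by (rule finite_subset) simp
    then have "Poly_Mapping.lookup (Abs_poly_mapping f) = f"
      by (simp add: Abs_poly_mapping_inverse)
    with sub show ?thesis
      by (intro image_eqI[of _ _ "Abs_poly_mapping f"])
         (simp_all add: Rn_def keys.rep_eq)
  qed
  moreover have "Poly_Mapping.lookup x i = 0" if "x \<in> Rn d" "d \<le> i" for x i
    using that by (force simp: Rn_def in_keys_iff)
  ultimately show ?thesis
    by (auto simp: bij_betw_def inj_on_def topspace_Euclidean_space poly_mapping_eqI)
qed

text \<open>
  A family of \<open>N\<close> color classes of \<open>r\<close> points each is \<open>P :: nat \<Rightarrow> nat \<Rightarrow> _\<close>, where \<open>P i j\<close> is the
  location of the \<open>j\<close>-th point of class \<open>i\<close> (\<open>i < N\<close>, \<open>j < r\<close>).  The points themselves are the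
  labels \<open>(i, j)\<close>: they stay different even when their locations coincide.
\<close>

definition color_class :: "nat \<Rightarrow> nat \<Rightarrow> (nat \<times> nat) set"
  where "color_class r i = {i} \<times> {..<r}"

definition colorful_partition :: "nat \<Rightarrow> nat \<Rightarrow> (nat \<Rightarrow> (nat \<times> nat) set) \<Rightarrow> bool"
  where "colorful_partition N r A \<longleftrightarrow>
    disjoint_family_on A {..<r} \<and>
    (\<Union>k<r. A k) = (\<Union>i<N. color_class r i) \<and>
    (\<forall>k<r. \<forall>i<N. card (A k \<inter> color_class r i) = 1)"

definition remaining_points ::
    "(nat \<Rightarrow> nat \<Rightarrow> 'a) \<Rightarrow> nat \<Rightarrow> nat set \<Rightarrow> (nat \<times> nat) set \<Rightarrow> 'a set"
  where "remaining_points P r T B = (\<lambda>(i, j). P i j) ` (B - (\<Union>i\<in>T. color_class r i))"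

end

theory Submission
  imports Defs "HOL-Combinatorics.Permutations"
begin

text \<open>
  The partition is chosen at random: in every color class, an independent uniformly random
  permutation \<open>\<sigma> i\<close> sends the point \<open>(i, j)\<close> to the part \<open>\<sigma> i j\<close>.

  Suppose that some \<open>t\<close> classes can be removed so that the hulls of the rest have no common
  point.  Then (\<open>separating_affine_functionals\<close>) there are affine functionals
  \<open>\<ell>\<^sub>1, \<dots>, \<ell>\<^sub>r\<close> with sum zero such that \<open>\<ell>\<^sub>k\<close> is positive on what remains of the \<open>k\<close>-th
  part.  In other words, only the removed classes, of which there are \<open>t\<close>, can contain a point
  on which the functional of its part is not positive; call a class with such a point a hit.

  Fix the functionals.  As they sum to zero, each point has at least one part whose functional
  is not positive on it.  So the class is hit unless the random permutation avoids a certain map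
  from points to parts.  Among all maps, bijections are the easiest to avoid
  (\<open>card_avoiding_le_derangements\<close>), hence the probability of a hit is at least
  \<open>q\<^sub>r = 1 - D\<^sub>r / r!\<close>, where \<open>D\<^sub>r\<close> is the number of derangements, and \<open>q\<^sub>r\<close> tends to
  \<open>1 - 1 / e\<close>.  This explains \<open>c\<^sub>r = 1 / q\<^sub>r\<close> and its limit \<open>e / (e - 1)\<close>: the expected number
  \<open>q\<^sub>r * N\<close> of hits has to exceed \<open>t\<close>.  By a Chernoff bound (\<open>card_few_successes\<close>), having at
  most \<open>t\<close> hits is then exponentially unlikely.

  It remains to treat all functionals simultaneously.  Only the signs of the functionals on the
  given points matter, and the tuples of functionals form a space of dimension \<open>r * (d + 1)\<close>;
  by the Sauer--Shelah lemma the number of sign patterns (\<open>card_halfspace_patterns\<close>) is at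
  most \<open>N * r\<^sup>2 + 1\<close> to that power.  A union bound over the patterns costs the term
  \<open>r * sqrt (t * d) + r * d\<close> with a logarithmic factor (\<open>union_bound_threshold\<close>).
\<close>

section \<open>Permutations that avoid a map\<close>

definition avoiding :: "'a set \<Rightarrow> ('a \<Rightarrow> 'a) \<Rightarrow> ('a \<Rightarrow> 'a) set"
  where "avoiding S f = {p. p permutes S \<and> (\<forall>x\<in>S. p x \<noteq> f x)}"

abbreviation derangements :: "'a set \<Rightarrow> ('a \<Rightarrow> 'a) set"
  where "derangements S \<equiv> avoiding S id"

lemma finite_avoiding: "finite S \<Longrightarrow> finite (avoiding S f)"
  unfolding avoiding_def by (rule finite_subset[OF _ finite_permutations]) auto

text \<open>
  If a value \<open>f y\<close> is taken twice and \<open>z\<close> is not taken at all, moving \<open>y\<close> to the value \<open>z\<close>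
  only makes avoidance easier.  The permutations that stop avoiding are those with \<open>p y = z\<close>;
  exchanging the values \<open>f y\<close> and \<open>z\<close> maps them injectively to permutations that start to avoid,
  because no other point has its forbidden value at \<open>z\<close> and \<open>y\<close> no longer has it at \<open>f y\<close>.
\<close>
lemma card_avoiding_separate_values:
  assumes S: "finite S" and xy: "x \<in> S" "y \<in> S" "x \<noteq> y" "f x = f y" "f x \<in> S"
    and z: "z \<in> S" "z \<notin> f ` S"
  shows "card (avoiding S f) \<le> card (avoiding S (f(y := z)))"
proof -
  let ?f' = "f(y := z)" and ?s = "Transposition.transpose (f y) z"
  define G where "G p = (if p y = z then ?s \<circ> p else p)" for p :: "'a \<Rightarrow> 'a"
  have zf: "f w \<noteq> z" if "w \<in> S" for w using z that by blast
  have G: "G p \<in> avoiding S ?f'" if p: "p \<in> avoiding S f" for p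
  proof (cases "p y = z")
    case False
    then show ?thesis using p by (auto simp: G_def avoiding_def)
  next
    case True
    have perm: "p permutes S" and av: "\<And>w. w \<in> S \<Longrightarrow> p w \<noteq> f w"
      using p by (auto simp: avoiding_def)
    have "?s \<circ> p permutes S"
      using perm xy z by (intro permutes_compose permutes_swap_id) auto
    moreover have "(?s \<circ> p) w \<noteq> ?f' w" if w: "w \<in> S" for w
    proof (cases "w = y")
      case True
      then show ?thesis using \<open>p y = z\<close> zf[OF xy(2)] by (simp add: Transposition.transpose_def)
    next
      case False
      then have "p w \<noteq> z" using \<open>p y = z\<close> permutes_inj[OF perm] by (metis injD)
      then show ?thesis using av[OF w] zf[OF w] False by (auto simp: Transposition.transpose_def)
    qed
    ultimately show ?thesis using True by (simp add: G_def avoiding_def)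
  qed
  have "inj_on G (avoiding S f)"
  proof (rule inj_onI)
    fix p p' assume p: "p \<in> avoiding S f" and p': "p' \<in> avoiding S f" and eq: "G p = G p'"
    have ney: "p y \<noteq> f y" "p' y \<noteq> f y" using p p' xy by (auto simp: avoiding_def)
    have y: "G p y = (if p y = z then f y else p y)" "G p' y = (if p' y = z then f y else p' y)"
      by (auto simp: G_def)
    have "(p y = z) = (p' y = z)" using y ney eq by (metis (full_types))
    moreover have "p = p'" if "?s \<circ> p = ?s \<circ> p'"
      using that by (metis comp_assoc id_comp transpose_comp_involutory)
    ultimately show "p = p'" using eq by (auto simp: G_def split: if_splits)
  qed
  then show ?thesis
    using G by (intro card_inj_on_le[of G]) (auto simp: finite_avoiding S)
qed

text \<open>
  Separating repeated values until none is left turns \<open>f\<close> into a permutation \<open>g\<close>, and \<open>p\<close>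
  avoids \<open>g\<close> exactly when \<open>inv g \<circ> p\<close> is a derangement.
\<close>
lemma card_avoiding_le_derangements:
  assumes "finite S" "f \<in> S \<rightarrow> S"
  shows "card (avoiding S f) \<le> card (derangements S)"
  using assms(2)
proof (induction "card S - card (f ` S)" arbitrary: f rule: less_induct)
  case less
  have sub: "f ` S \<subseteq> S" using less.prems by auto
  show ?case
  proof (cases "f ` S = S")
    case True
    define g where "g x = (if x \<in> S then f x else x)" for x
    have "bij_betw f S S"
      using True by (simp add: bij_betw_def eq_card_imp_inj_on assms(1))
    then have "bij_betw g S S" by (rule bij_betw_cong[THEN iffD1, rotated]) (simp add: g_def)
    then have g: "g permutes S" by (rule bij_imp_permutes) (simp add: g_def)
    let ?h = "\<lambda>p. inv g \<circ> p"
    have "inv g (p x) \<noteq> x" if "p \<in> avoiding S f" "x \<in> S" for p x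
      using that permutes_inv_eq[OF g] by (auto simp: avoiding_def g_def)
    then have "?h ` avoiding S f \<subseteq> derangements S"
      using permutes_compose permutes_inv[OF g] by (auto simp: avoiding_def)
    moreover have "inj_on ?h (avoiding S f)"
      by (rule inj_onI) (metis comp_assoc id_comp permutes_inv_o(1)[OF g])
    ultimately show ?thesis
      by (intro card_inj_on_le) (auto simp: finite_avoiding assms(1))
  next
    case False
    then obtain z where z: "z \<in> S" "z \<notin> f ` S" using sub by blast
    have "\<not> inj_on f S" using False sub assms(1) by (metis endo_inj_surj)
    then obtain x y where xy: "x \<in> S" "y \<in> S" "x \<noteq> y" "f x = f y" by (auto simp: inj_on_def)
    have "f(y := z) ` S = insert z (f ` S)"
    proof
      have "f w \<in> f(y := z) ` S" if "w \<in> S" for w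
      proof (cases "w = y")
        case True
        then have "f w = (f(y := z)) x" using xy by simp
        then show ?thesis using xy by blast
      next
        case False
        then have "f w = (f(y := z)) w" by simp
        then show ?thesis using that by blast
      qed
      moreover have "z \<in> f(y := z) ` S" using xy by (auto intro!: image_eqI[of _ _ y])
      ultimately show "insert z (f ` S) \<subseteq> f(y := z) ` S" by blast
    qed auto
    then have "card (f(y := z) ` S) = Suc (card (f ` S))" using z assms(1) by simp
    moreover have "card (f(y := z) ` S) \<le> card S" by (rule card_image_le[OF assms(1)])
    ultimately have "card (avoiding S (f(y := z))) \<le> card (derangements S)"
      using less.prems z by (intro less.hyps) auto
    moreover have "f x \<in> S" using xy less.prems by auto
    ultimately show ?thesis
      using card_avoiding_separate_values[OF assms(1) xy(1,2,3,4) _ z] by linarith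
  qed
qed

lemma sum_Pow_card:
  fixes g :: "nat \<Rightarrow> 'a::comm_semiring_1"
  assumes "finite S"
  shows "(\<Sum>I\<in>Pow S. g (card I)) = (\<Sum>k\<le>card S. of_nat (card S choose k) * g k)"
proof -
  have "(\<Sum>I\<in>Pow S. g (card I)) = (\<Sum>k\<in>{..card S}. \<Sum>I\<in>{I\<in>Pow S. card I = k}. g (card I))"
    using assms by (intro sum.group[symmetric]) (auto intro: card_mono)
  also have "\<dots> = (\<Sum>k\<le>card S. of_nat (card S choose k) * g k)"
    using n_subsets[OF assms] by (intro sum.cong) auto
  finally show ?thesis .
qed

text \<open>
  The indicator of a derangement is the product of \<open>1 - [p x = x]\<close> over all \<open>x\<close>; the term
  of a set \<open>I\<close> in its expansion counts, up to sign, the permutations of \<open>S - I\<close>.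
\<close>
lemma derangement_density:
  assumes "finite S"
  shows "real (card (derangements S)) / fact (card S) = (\<Sum>k\<le>card S. (- 1) ^ k / fact k)"
proof -
  let ?P = "{p. p permutes S}"
  have finP: "finite ?P" by (rule finite_permutations[OF assms])
  have ind: "(if p \<in> derangements S then 1 else 0) = (\<Sum>I\<in>Pow S. \<Prod>x\<in>I. if p x = x then - 1 else (0::real))"
    if "p \<in> ?P" for p
  proof -
    have "(if p \<in> derangements S then 1 else 0) = (\<Prod>x\<in>S. (if p x = x then - 1 else (0::real)) + 1)"
      using that assms by (auto simp: avoiding_def intro!: prod.neutral[symmetric])
    then show ?thesis by (simp add: prod_add[OF assms])
  qed
  have fixing: "(\<Sum>p\<in>?P. \<Prod>x\<in>I. if p x = x then - 1 else (0::real)) = (- 1) ^ card I * fact (card S - card I)"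
    if I: "I \<in> Pow S" for I
  proof -
    have finI: "finite I" using I assms finite_subset by auto
    have "{p\<in>?P. \<forall>x\<in>I. p x = x} = {p. p permutes (S - I)}"
      using I by (auto intro: permutes_superset permutes_subset simp: permutes_not_in)
    then have "card {p\<in>?P. \<forall>x\<in>I. p x = x} = fact (card S - card I)"
      using I finI assms by (simp add: card_permutations card_Diff_subset)
    moreover have "(\<Prod>x\<in>I. if p x = x then - 1 else (0::real))
        = (if \<forall>x\<in>I. p x = x then (- 1) ^ card I else 0)" for p
      using finI by auto
    ultimately show ?thesis using finP by (simp add: sum.If_cases Int_def)
  qed
  have "real (card (derangements S)) = (\<Sum>p\<in>?P. if p \<in> derangements S then 1 else 0)"
    using finP by (simp add: sum.If_cases Int_def) (auto simp: avoiding_def intro: arg_cong[where f = card])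
  also have "\<dots> = (\<Sum>p\<in>?P. \<Sum>I\<in>Pow S. \<Prod>x\<in>I. if p x = x then - 1 else 0)"
    by (intro sum.cong ind) auto
  also have "\<dots> = (\<Sum>I\<in>Pow S. (- 1) ^ card I * fact (card S - card I))"
    by (subst sum.swap) (intro sum.cong fixing refl)
  also have "\<dots> = (\<Sum>k\<le>card S. of_nat (card S choose k) * ((- 1) ^ k * fact (card S - k)))"
    by (rule sum_Pow_card[OF assms])
  also have "\<dots> = (\<Sum>k\<le>card S. fact (card S) * ((- 1) ^ k / fact k))"
    by (intro sum.cong) (simp_all add: binomial_fact)
  also have "\<dots> = fact (card S) * (\<Sum>k\<le>card S. (- 1) ^ k / fact k)"
    by (rule sum_distrib_left[symmetric])
  finally show ?thesis by simp
qed

text \<open>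
  The probability that a uniformly random permutation of \<open>r\<close> elements has a fixed point.  It is
  the least probability of agreeing somewhere with a prescribed self-map of \<open>{..<r}\<close>, and its
  reciprocal is the coefficient \<open>c\<^sub>r\<close> of the theorem.
\<close>
definition hit_probability :: "nat \<Rightarrow> real"
  where "hit_probability r = 1 - real (card (derangements {..<r})) / fact r"

lemma hit_probability_pos:
  assumes "1 \<le> r"
  shows "hit_probability r > 0"
proof -
  have "derangements {..<r} \<subset> {p. p permutes {..<r}}"
  proof
    have "id \<notin> derangements {..<r}" using assms by (auto simp: avoiding_def intro!: exI[of _ 0])
    then show "derangements {..<r} \<noteq> {p. p permutes {..<r}}" by (metis mem_Collect_eq permutes_id)
  qed (auto simp: avoiding_def)
  then have "card (derangements {..<r}) < card {p. p permutes {..<r}}"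
    by (intro psubset_card_mono) (auto simp: finite_permutations)
  then have "card (derangements {..<r}) < fact r" by (simp add: card_permutations)
  then have "real (card (derangements {..<r})) < fact r" by (metis of_nat_fact of_nat_less_iff)
  then show ?thesis by (simp add: hit_probability_def)
qed

lemma hit_probability_tendsto: "hit_probability \<longlonglongrightarrow> 1 - exp (- 1)"
proof -
  have "(\<lambda>k. (- 1) ^ k / fact k) sums exp (- 1 :: real)"
    using exp_converges[of "- 1 :: real"] by (simp add: divide_inverse mult.commute)
  then have "(\<lambda>r. \<Sum>k\<le>r. (- 1) ^ k / fact k) \<longlonglongrightarrow> exp (- 1 :: real)"
    by (simp add: sums_def_le)
  moreover have "hit_probability = (\<lambda>r. 1 - (\<Sum>k\<le>r. (- 1) ^ k / fact k))"
    proof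
    fix r
    show "hit_probability r = 1 - (\<Sum>k\<le>r. (- 1) ^ k / fact k)"
      using derangement_density[of "{..<r}"] by (simp add: hit_probability_def)
  qed
  ultimately show ?thesis using tendsto_diff[OF tendsto_const] by metis
qed

section \<open>Separating convex hulls without a common point\<close>

lemma compact_product:
  fixes C :: "'i \<Rightarrow> 'a::topological_space set"
  assumes "\<And>i. compact (C i)"
  shows "compact (PiE UNIV C)"
proof -
  have "compactin (product_topology (\<lambda>i. euclidean) UNIV) (PiE UNIV C)"
    unfolding compactin_PiE using assms by simp
  then show ?thesis by (simp add: euclidean_product_topology)
qed

text \<open>
  When the hulls have no common point, the family can be separated all at once: some affine
  functionals \<open>\<ell>\<^sub>k\<close> sum to zero identically, while each \<open>\<ell>\<^sub>k\<close> is positive on \<open>B k\<close>.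
  This is Sarkaria's reduction in dual form.  Choose \<open>y k\<close> in the hull of \<open>B k\<close> minimising
  the sum of squared distances to their mean.  The deviations \<open>A y k\<close> from the mean sum to zero,
  they do not all vanish, and by minimality the linear functional with coefficients \<open>A y k\<close> takes
  its least value on the hull of \<open>B k\<close> at \<open>y k\<close>.  These least values add up to the minimum
  \<open>F y > 0\<close>, so constants that sum to zero make all of them equal to \<open>F y / r\<close>.
  
  The functionals \<open>\<phi> c\<close> play the part of Euclidean coordinates, so that squared distances make
  sense in any normed space.
\<close>
lemma separating_affine_functionals:
  fixes \<phi> :: "'c \<Rightarrow> 'a::real_normed_vector \<Rightarrow> real" and B :: "'k \<Rightarrow> 'a set"
  assumes I: "finite I" and J: "finite J" and fin: "\<And>k. k \<in> J \<Longrightarrow> finite (B k)"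
    and lin: "\<And>c. c \<in> I \<Longrightarrow> bounded_linear (\<phi> c)"
    and inj: "\<And>x y k l. k \<in> J \<Longrightarrow> l \<in> J \<Longrightarrow> x \<in> convex hull (B k) \<Longrightarrow> y \<in> convex hull (B l)
                \<Longrightarrow> (\<And>c. c \<in> I \<Longrightarrow> \<phi> c x = \<phi> c y) \<Longrightarrow> x = y"
    and empty: "(\<Inter>k\<in>J. convex hull (B k)) = {}"
  obtains a :: "'k \<Rightarrow> 'c \<Rightarrow> real" and b :: "'k \<Rightarrow> real"
  where "\<And>c. (\<Sum>k\<in>J. a k c) = 0" "(\<Sum>k\<in>J. b k) = 0"
    "\<And>k x. k \<in> J \<Longrightarrow> x \<in> B k \<Longrightarrow> 0 < (\<Sum>c\<in>I. a k c * \<phi> c x) + b k"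
proof (cases "\<exists>k0\<in>J. B k0 = {}")
  case True
  then obtain k0 where k0: "k0 \<in> J" "B k0 = {}" by blast
  \<comment> \<open>An empty hull makes the condition on \<open>k0\<close> void, so constant functionals suffice.\<close>
  define b where "b k = (if k = k0 then - real (card (J - {k0})) else 1)" for k
  have "sum b (J - {k0}) = (\<Sum>k\<in>J - {k0}. 1)" by (rule sum.cong) (auto simp: b_def)
  then have "sum b J = 0" using k0 J by (simp add: sum.remove[of J k0] b_def)
  moreover have "0 < (\<Sum>c\<in>I. 0 * \<phi> c x) + b k" if "x \<in> B k" for k x
    using that k0 by (auto simp: b_def)
  ultimately show ?thesis using that[of "\<lambda>_ _. 0" b] by auto
next
  case False
  then have ne: "B k \<noteq> {}" if "k \<in> J" for k using that by blast
  have Jne: "J \<noteq> {}" using empty by auto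
  define C where "C k = (if k \<in> J then convex hull (B k) else {0})" for k
  define r where "r = real (card J)"
  have r: "r > 0" using Jne J by (auto simp: r_def card_gt_0_iff)
  define mean where "mean y c = (\<Sum>k\<in>J. \<phi> c (y k)) / r" for y :: "'k \<Rightarrow> 'a" and c
  define A where "A y k c = \<phi> c (y k) - mean y c" for y :: "'k \<Rightarrow> 'a" and k c
  define F where "F y = (\<Sum>k\<in>J. \<Sum>c\<in>I. (A y k c)\<^sup>2)" for y :: "'k \<Rightarrow> 'a"
  have Asum: "(\<Sum>k\<in>J. A y k c) = 0" for y c
    using r by (simp add: A_def sum_subtractf mean_def r_def)
  have cont: "continuous_on UNIV (\<lambda>y :: 'k \<Rightarrow> 'a. \<phi> c (y k))" if "c \<in> I" for c k
    using continuous_on_compose2[OF linear_continuous_on[OF lin[OF that], of UNIV]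
        continuous_on_product_coordinates[of k]] by simp
  have "continuous_on UNIV F"
    unfolding F_def A_def mean_def using r
    by (intro continuous_intros cont) auto
  moreover have "compact (PiE UNIV C)"
    using fin by (intro compact_product) (auto simp: C_def finite_imp_compact_convex_hull)
  moreover have "PiE UNIV C \<noteq> {}" using ne by (auto simp: PiE_eq_empty_iff C_def)
  ultimately obtain y where y: "y \<in> PiE UNIV C" and min: "\<And>z. z \<in> PiE UNIV C \<Longrightarrow> F y \<le> F z"
    using continuous_attains_inf[of "PiE UNIV C" F] continuous_on_subset[of UNIV F] by blast
  have yC: "y k \<in> convex hull (B k)" if "k \<in> J" for k
    using PiE_mem[OF y, of k] that by (simp add: C_def)
  have Fpos: "F y > 0"
  proof (rule ccontr)
    assume "\<not> F y > 0"
    then have "F y = 0" by (simp add: F_def sum_nonneg order_antisym not_less)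
    then have "A y k c = 0" if "k \<in> J" "c \<in> I" for k c
      using that I J by (simp add: F_def sum_nonneg_eq_0_iff sum_nonneg)
    then have eq: "\<phi> c (y k) = \<phi> c (y l)" if "k \<in> J" "l \<in> J" "c \<in> I" for k l c
      using that by (simp add: A_def)
    obtain k0 where k0: "k0 \<in> J" using Jne by blast
    have "y k0 = y k" if "k \<in> J" for k
      using inj[OF k0 that yC[OF k0] yC[OF that]] eq k0 that by blast
    then have "y k0 \<in> (\<Inter>k\<in>J. convex hull (B k))" using yC by auto
    then show False using empty by blast
  qed
  define b where "b k = F y / r - (\<Sum>c\<in>I. A y k c * \<phi> c (y k))" for k
  have self: "(\<Sum>k\<in>J. \<Sum>c\<in>I. A y k c * \<phi> c (y k)) = F y"
  proof -
    have "(\<Sum>k\<in>J. A y k c * \<phi> c (y k)) = (\<Sum>k\<in>J. (A y k c)\<^sup>2)" for c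
    proof -
      have "(\<Sum>k\<in>J. A y k c * \<phi> c (y k)) = (\<Sum>k\<in>J. (A y k c)\<^sup>2 + A y k c * mean y c)"
        by (intro sum.cong) (auto simp: A_def power2_eq_square algebra_simps)
      then show ?thesis using Asum[of y c] by (simp add: sum.distrib flip: sum_distrib_right)
    qed
    then show ?thesis unfolding F_def by (subst (1 2) sum.swap) simp
  qed
  have "(\<Sum>k\<in>J. b k) = 0"
    using r self by (simp add: b_def sum_subtractf r_def)
  moreover have "0 < (\<Sum>c\<in>I. A y k c * \<phi> c x) + b k" if k: "k \<in> J" and x: "x \<in> B k" for k x
  proof -
    define h where "h c = \<phi> c x - \<phi> c (y k)" for c
    define Q where "Q = (\<Sum>l\<in>J. \<Sum>c\<in>I. ((if l = k then h c else 0) - h c / r)\<^sup>2)"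
    define D where "D = (\<Sum>c\<in>I. A y k c * h c)"
    \<comment> \<open>First-order optimality of \<open>y k\<close>: move it a fraction \<open>e\<close> towards \<open>x\<close>.  The mean moves by
      \<open>e * h / r\<close>, but its contribution to the linear term cancels because the deviations
      sum to zero.\<close>
    have step: "0 \<le> 2 * D + e * Q" if e: "0 < e" "e \<le> 1" for e
    proof -
      define z where "z = y(k := (1 - e) *\<^sub>R y k + e *\<^sub>R x)"
      have "(1 - e) *\<^sub>R y k + e *\<^sub>R x \<in> convex hull (B k)"
        using e x yC[OF k] by (intro convexD[OF convex_convex_hull]) (auto intro: hull_inc)
      then have "z \<in> PiE UNIV C" using k PiE_mem[OF y] by (simp add: PiE_iff z_def C_def[of k])
      then have "F y \<le> F z" by (rule min)
      also have "F z = F y + 2 * e * D + e\<^sup>2 * Q"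
      proof -
        have phiz: "\<phi> c (z l) = \<phi> c (y l) + e * (if l = k then h c else 0)" if "c \<in> I" for c l
        proof -
          interpret bounded_linear "\<phi> c" using lin[OF that] .
          show ?thesis by (simp add: z_def h_def add scaleR left_diff_distrib right_diff_distrib)
        qed
        have "mean z c = mean y c + e * (h c / r)" if "c \<in> I" for c
          using k J that by (simp add: mean_def phiz sum.distrib add_divide_distrib flip: sum_distrib_left)
        then have Az: "A z l c = A y l c + e * ((if l = k then h c else 0) - h c / r)" if "c \<in> I" for l c
          using that by (simp add: A_def phiz algebra_simps)
        have "F z = (\<Sum>l\<in>J. \<Sum>c\<in>I. (A y l c)\<^sup>2 + 2 * e * (A y l c * ((if l = k then h c else 0) - h c / r))
            + e\<^sup>2 * ((if l = k then h c else 0) - h c / r)\<^sup>2)"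
          unfolding F_def by (intro sum.cong refl) (simp add: Az power2_eq_square algebra_simps)
        also have "\<dots> = F y + 2 * e * (\<Sum>l\<in>J. \<Sum>c\<in>I. A y l c * ((if l = k then h c else 0) - h c / r)) + e\<^sup>2 * Q"
          by (simp add: F_def Q_def sum.distrib sum_distrib_left)
        also have "(\<Sum>l\<in>J. \<Sum>c\<in>I. A y l c * ((if l = k then h c else 0) - h c / r)) = D"
        proof -
          have "(\<Sum>l\<in>J. A y l c * ((if l = k then h c else 0) - h c / r)) = A y k c * h c" for c
          proof -
            have "(\<Sum>l\<in>J. A y l c * ((if l = k then h c else 0) - h c / r))
              = (\<Sum>l\<in>J. (if l = k then A y l c * h c else 0)) - (\<Sum>l\<in>J. A y l c) * (h c / r)"
              unfolding sum_distrib_right sum_subtractf[symmetric]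
              by (intro sum.cong) (auto simp: algebra_simps)
            then show ?thesis using k J by (simp add: Asum)
          qed
          then show ?thesis unfolding D_def by (subst sum.swap) simp
        qed
        finally show ?thesis .
      qed
      finally have "0 \<le> e * (2 * D + e * Q)" by (simp add: power2_eq_square algebra_simps)
      then show ?thesis using e by (simp add: zero_le_mult_iff)
    qed
    have "0 \<le> D"
    proof (rule ccontr)
      assume neg: "\<not> 0 \<le> D"
      have Q: "0 \<le> Q" by (simp add: Q_def sum_nonneg)
      define e where "e = min 1 (- D / (Q + 1))"
      have e: "0 < e" "e \<le> 1" "e \<le> - D / (Q + 1)" using neg Q by (auto simp: e_def divide_less_0_iff)
      have "e * Q \<le> e * (Q + 1)" using e by (intro mult_left_mono) auto
      also have "\<dots> \<le> - D" using e(3) Q by (simp add: field_simps)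
      finally show False using step[OF e(1,2)] neg by linarith
    qed
    then have "(\<Sum>c\<in>I. A y k c * \<phi> c (y k)) \<le> (\<Sum>c\<in>I. A y k c * \<phi> c x)"
      by (simp add: D_def h_def right_diff_distrib sum_subtractf)
    moreover have "F y / r > 0" using Fpos r by simp
    ultimately show ?thesis by (simp add: b_def)
  qed
  ultimately show ?thesis using that[of "A y" b] Asum by blast
qed

lemma bounded_linear_lookup: "bounded_linear (\<lambda>x :: 'a \<Rightarrow>\<^sub>0 real. Poly_Mapping.lookup x c)"
proof (rule bounded_linear_intro[where K = 1])
  fix x :: "'a \<Rightarrow>\<^sub>0 real" and e :: real
  show "Poly_Mapping.lookup (e *\<^sub>R x) c = e *\<^sub>R Poly_Mapping.lookup x c"
    by (cases "e = 0") (simp_all add: scaleR_poly_mapping_def)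
  show "norm (Poly_Mapping.lookup x c) \<le> norm x * 1"
  proof (cases "c \<in> Poly_Mapping.keys x")
    case True
    then show ?thesis
      by (auto simp: norm_poly_mapping_def dist_poly_mapping_def intro: member_le_sum)
  qed (simp add: in_keys_iff)
qed (simp add: lookup_add)

lemma convex_Rn: "convex (Rn d)"
proof (rule convexI)
  fix x y and u v :: real
  assume xy: "x \<in> Rn d" "y \<in> Rn d"
  have "Poly_Mapping.lookup (u *\<^sub>R x + v *\<^sub>R y) i = 0" if "i \<notin> {..<d}" for i
  proof -
    have "Poly_Mapping.lookup x i = 0" "Poly_Mapping.lookup y i = 0"
      using xy that by (auto simp: Rn_def in_keys_iff)
    then show ?thesis
      using bounded_linear.linear[OF bounded_linear_lookup, THEN linear_scale, of _ _ i] by (simp add: lookup_add)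
  qed
  then show "u *\<^sub>R x + v *\<^sub>R y \<in> Rn d" by (force simp: Rn_def in_keys_iff)
qed

section \<open>Sign patterns of linear functionals\<close>

definition shattered :: "'a set set \<Rightarrow> 'a set \<Rightarrow> bool"
  where "shattered F S \<longleftrightarrow> (\<forall>B\<subseteq>S. \<exists>A\<in>F. A \<inter> S = B)"

text \<open>
  Pajor's form of the Sauer--Shelah lemma.  For a point \<open>x\<close>, let \<open>U\<close> be the family of traces of
  members of \<open>F\<close> on \<open>X\<close>, and \<open>V\<close> the family of those traces that occur both with and without
  \<open>x\<close>, so that \<open>card F = card U + card V\<close>.  A set shattered by \<open>U\<close> is shattered by \<open>F\<close>, and a
  set shattered by \<open>V\<close> stays shattered by \<open>F\<close> after \<open>x\<close> is added.
\<close>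
lemma card_le_card_shattered:
  assumes "finite X" "F \<subseteq> Pow X"
  shows "card F \<le> card {S. S \<subseteq> X \<and> shattered F S}"
  using assms
proof (induction X arbitrary: F rule: finite_induct)
  case empty
  then consider "F = {}" | "F = {{}}" by auto
  then show ?case
  proof cases
    case 2
    then have "{S. S \<subseteq> {} \<and> shattered F S} = {{}}" by (auto simp: shattered_def)
    then show ?thesis using 2 by simp
  qed simp
next
  case (insert x X)
  define U where "U = {A\<in>Pow X. A \<in> F \<or> insert x A \<in> F}"
  define V where "V = {A\<in>Pow X. A \<in> F \<and> insert x A \<in> F}"
  let ?sh = "\<lambda>G. {S. S \<subseteq> X \<and> shattered G S}"
  have fin: "finite (Pow X)" "finite (?sh U)" "finite (?sh V)" "finite U" "finite V"
    using insert.hyps(1) by (auto simp: U_def V_def)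
  let ?F0 = "{A\<in>Pow X. A \<in> F}" and ?F1 = "{A\<in>Pow X. insert x A \<in> F}"
  have inj: "inj_on (insert x) (Pow X)"
    by (rule inj_onI) (metis Diff_insert_absorb PowD insert.hyps(2) subsetD)
  have F: "F = ?F0 \<union> insert x ` ?F1"
  proof (intro equalityI subsetI)
    fix A assume A: "A \<in> F"
    show "A \<in> ?F0 \<union> insert x ` ?F1"
    proof (cases "x \<in> A")
      case True
      then have "A = insert x (A - {x})" by auto
      moreover have "A - {x} \<in> ?F1" using A True insert.prems by (auto simp: insert_absorb)
      ultimately show ?thesis by blast
    qed (use A insert.prems in auto)
  qed auto
  have "card (?F0 \<union> insert x ` ?F1) = card ?F0 + card (insert x ` ?F1)"
    using insert.hyps fin by (intro card_Un_disjoint) auto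
  moreover have "card (insert x ` ?F1) = card ?F1"
    by (intro card_image inj_on_subset[OF inj]) auto
  moreover have "card ?F0 + card ?F1 = card U + card V"
  proof -
    have "U = ?F0 \<union> ?F1" "V = ?F0 \<inter> ?F1" by (auto simp: U_def V_def)
    then show ?thesis using card_Un_Int[of ?F0 ?F1] insert.hyps(1) by simp
  qed
  moreover have "card F = card (?F0 \<union> insert x ` ?F1)" by (rule arg_cong[OF F])
  ultimately have "card F = card U + card V" by linarith
  also have "\<dots> \<le> card (?sh U) + card (?sh V)"
    by (intro add_mono insert.IH) (auto simp: U_def V_def)
  also have "\<dots> = card (?sh U \<union> insert x ` ?sh V)"
  proof -
    have "card (insert x ` ?sh V) = card (?sh V)"
      by (intro card_image inj_on_subset[OF inj]) auto
    moreover have "?sh U \<inter> insert x ` ?sh V = {}" using insert.hyps by auto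
    ultimately show ?thesis using fin by (simp add: card_Un_disjoint)
  qed
  also have "\<dots> \<le> card {S. S \<subseteq> insert x X \<and> shattered F S}"
  proof (intro card_mono)
    show "finite {S. S \<subseteq> insert x X \<and> shattered F S}" using insert.hyps(1) by simp
    have "shattered F S" if S: "S \<subseteq> X" "shattered U S" for S
      unfolding shattered_def
    proof (intro allI impI)
      fix B assume "B \<subseteq> S"
      then obtain A where A: "A \<in> U" "A \<inter> S = B" using S unfolding shattered_def by meson
      moreover have "insert x A \<inter> S = A \<inter> S" using S insert.hyps by auto
      ultimately show "\<exists>A\<in>F. A \<inter> S = B" by (auto simp: U_def)
    qed
    moreover have "shattered F (insert x S)" if S: "S \<subseteq> X" "shattered V S" for S
      unfolding shattered_def
    proof (intro allI impI)
      fix B assume B: "B \<subseteq> insert x S"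
      then have "B - {x} \<subseteq> S" by auto
      then obtain A where A: "A \<in> V" "A \<inter> S = B - {x}" using S unfolding shattered_def by meson
      then have "x \<notin> A" using insert.hyps by (auto simp: V_def)
      show "\<exists>A\<in>F. A \<inter> insert x S = B"
      proof (cases "x \<in> B")
        case True
        then have "insert x A \<inter> insert x S = B" using A(2) B by auto
        then show ?thesis using A(1) unfolding V_def by blast
      next
        case False
        then have "A \<inter> insert x S = B" using A(2) B \<open>x \<notin> A\<close> by auto
        then show ?thesis using A(1) unfolding V_def by blast
      qed
    qed
    ultimately show "?sh U \<union> insert x ` ?sh V \<subseteq> {S. S \<subseteq> insert x X \<and> shattered F S}" by blast
  qed
  finally show ?case .
qed

lemma card_bounded_subsets:
  assumes "finite X"
  shows "card {S. S \<subseteq> X \<and> card S \<le> D} \<le> (card X + 1) ^ D"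
proof -
  have "{S. S \<subseteq> X \<and> card S \<le> D} = (\<Union>i\<le>D. {S. S \<subseteq> X \<and> card S = i})" by auto
  then have "card {S. S \<subseteq> X \<and> card S \<le> D} \<le> (\<Sum>i\<le>D. card {S. S \<subseteq> X \<and> card S = i})"
    by (simp add: card_UN_le)
  also have "\<dots> = (\<Sum>i\<le>D. card X choose i)" by (simp add: n_subsets[OF assms])
  also have "\<dots> \<le> (\<Sum>i\<le>D. (D choose i) * card X ^ i)"
  proof (intro sum_mono)
    fix i assume "i \<in> {..D}"
    then have "1 * card X ^ i \<le> (D choose i) * card X ^ i"
      by (intro mult_right_mono) (auto simp: Suc_le_eq)
    moreover have "card X choose i \<le> card X ^ i"
      by (cases "i \<le> card X") (auto simp: binomial_le_pow binomial_eq_0)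
    ultimately show "card X choose i \<le> (D choose i) * card X ^ i" by linarith
  qed
  also have "\<dots> = (card X + 1) ^ D" using binomial[of "card X" 1 D] by simp
  finally show ?thesis .
qed

lemma underdetermined_system_nontrivial:
  fixes \<phi> :: "'x \<Rightarrow> 'k \<Rightarrow> 'a::field"
  assumes "finite K" "finite S" "card K < card S"
  obtains c where "\<exists>s\<in>S. c s \<noteq> 0" "\<And>k. k \<in> K \<Longrightarrow> (\<Sum>s\<in>S. c s * \<phi> s k) = 0"
proof -
  have "\<exists>c. (\<exists>s\<in>S. c s \<noteq> 0) \<and> (\<forall>k\<in>K. (\<Sum>s\<in>S. c s * \<phi> s k) = 0)"
    using assms
  proof (induction K arbitrary: S \<phi> rule: finite_induct)
    case empty
    then have "\<exists>s\<in>S. (1::'a) \<noteq> 0" by (auto simp: card_gt_0_iff)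
    then show ?case by (intro exI[of _ "\<lambda>_. 1"]) auto
  next
    case (insert k0 K)
    show ?case
    proof (cases "\<forall>s\<in>S. \<phi> s k0 = 0")
      case True
      have "card K < card S" using insert.prems insert.hyps by simp
      then obtain c where "\<exists>s\<in>S. c s \<noteq> 0" "\<forall>k\<in>K. (\<Sum>s\<in>S. c s * \<phi> s k) = 0"
        using insert.IH[of S \<phi>] insert.prems by blast
      then show ?thesis using True by (intro exI[of _ c]) auto
    next
      case False
      then obtain s0 where s0: "s0 \<in> S" "\<phi> s0 k0 \<noteq> 0" by blast
      let ?T = "S - {s0}" and ?q = "\<lambda>s. \<phi> s k0 / \<phi> s0 k0"
      have "card K < card ?T" using insert.prems insert.hyps s0 by simp
      then obtain c where c: "\<exists>s\<in>?T. c s \<noteq> 0"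
          "\<forall>k\<in>K. (\<Sum>s\<in>?T. c s * (\<phi> s k - ?q s * \<phi> s0 k)) = 0"
        using insert.IH[of ?T "\<lambda>s k. \<phi> s k - ?q s * \<phi> s0 k"] insert.prems by blast
      define c' where "c' = c(s0 := - (\<Sum>s\<in>?T. c s * ?q s))"
      have "(\<Sum>s\<in>S. c' s * \<phi> s k) = (\<Sum>s\<in>?T. c s * (\<phi> s k - ?q s * \<phi> s0 k))" for k
      proof -
        have "(\<Sum>s\<in>S. c' s * \<phi> s k) = c' s0 * \<phi> s0 k + (\<Sum>s\<in>?T. c' s * \<phi> s k)"
          using s0 insert.prems by (simp add: sum.remove)
        also have "(\<Sum>s\<in>?T. c' s * \<phi> s k) = (\<Sum>s\<in>?T. c s * \<phi> s k)"
          by (rule sum.cong) (auto simp: c'_def)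
        also have "c' s0 * \<phi> s0 k = - (\<Sum>s\<in>?T. c s * ?q s * \<phi> s0 k)"
          by (simp add: c'_def sum_distrib_right)
        finally show ?thesis by (simp add: right_diff_distrib sum_subtractf mult.assoc)
      qed
      moreover have "(\<Sum>s\<in>?T. c s * (\<phi> s k0 - ?q s * \<phi> s0 k0)) = 0" using s0 by simp
      moreover have "\<exists>s\<in>S. c' s \<noteq> 0" using c(1) by (auto simp: c'_def)
      ultimately show ?thesis using c(2) by (intro exI[of _ c']) auto
    qed
  qed
  then show ?thesis using that by blast
qed

definition positive_part :: "'k set \<Rightarrow> ('x \<Rightarrow> 'k \<Rightarrow> real) \<Rightarrow> 'x set \<Rightarrow> ('k \<Rightarrow> real) \<Rightarrow> 'x set"
  where "positive_part K \<phi> X u = {x\<in>X. 0 < (\<Sum>k\<in>K. u k * \<phi> x k)}"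

text \<open>
  More than \<open>card K\<close> feature vectors satisfy a nontrivial linear relation \<open>c\<close>.  A functional
  that is positive exactly where \<open>c\<close> is positive would make every term of the relation
  nonnegative and some term positive.
\<close>
lemma card_shattered_by_halfspaces:
  assumes K: "finite K" and S: "finite S" "shattered (range (positive_part K \<phi> X)) S"
  shows "card S \<le> card K"
proof (rule ccontr)
  assume "\<not> card S \<le> card K"
  then obtain c where c: "\<exists>s\<in>S. c s \<noteq> 0" "\<And>k. k \<in> K \<Longrightarrow> (\<Sum>s\<in>S. c s * \<phi> s k) = 0"
    using underdetermined_system_nontrivial[OF K S(1), of \<phi>] by (metis not_le)
  have contra: False if pos: "\<exists>s\<in>S. 0 < e s" and e: "\<And>k. k \<in> K \<Longrightarrow> (\<Sum>s\<in>S. e s * \<phi> s k) = 0" for e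
  proof -
    have "{s\<in>S. 0 < e s} \<subseteq> S" by auto
    then obtain u where u: "positive_part K \<phi> X u \<inter> S = {s\<in>S. 0 < e s}"
      using S(2) unfolding shattered_def by blast
    have "S \<subseteq> X" using S(2)[unfolded shattered_def, rule_format, of S] by (auto simp: positive_part_def)
    let ?u = "\<lambda>s. \<Sum>k\<in>K. u k * \<phi> s k"
    have sgn: "0 < ?u s \<longleftrightarrow> 0 < e s" if "s \<in> S" for s
      using u that \<open>S \<subseteq> X\<close> by (auto simp: positive_part_def)
    have "0 \<le> e s * ?u s" if "s \<in> S" for s
      using sgn[OF that] by (cases "0 < e s") (auto simp: not_less intro!: mult_nonneg_nonneg mult_nonpos_nonpos)
    moreover obtain s where "s \<in> S" "0 < e s * ?u s" using pos sgn by (metis mult_pos_pos)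
    ultimately have "0 < (\<Sum>s\<in>S. e s * ?u s)" using S(1) by (intro sum_pos2)
    also have "(\<Sum>s\<in>S. e s * ?u s) = (\<Sum>s\<in>S. \<Sum>k\<in>K. u k * (e s * \<phi> s k))"
      by (simp add: sum_distrib_left mult.left_commute)
    also have "\<dots> = (\<Sum>k\<in>K. u k * (\<Sum>s\<in>S. e s * \<phi> s k))"
      by (subst sum.swap) (simp add: sum_distrib_left)
    finally show False using e by simp
  qed
  from c(1) obtain s where "s \<in> S" "c s \<noteq> 0" by blast
  then consider "\<exists>s\<in>S. 0 < c s" | "\<exists>s\<in>S. 0 < - c s" by fastforce
  then show False
    by cases (use contra[of c] contra[of "\<lambda>s. - c s"] c(2) in \<open>auto simp: sum_negf\<close>)
qed

lemma card_halfspace_patterns: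
  assumes "finite K" "finite X"
  shows "card (range (positive_part K \<phi> X)) \<le> (card X + 1) ^ card K"
proof -
  let ?F = "range (positive_part K \<phi> X)"
  have "card ?F \<le> card {S. S \<subseteq> X \<and> shattered ?F S}"
    using assms(2) by (intro card_le_card_shattered) (auto simp: positive_part_def)
  also have "\<dots> \<le> card {S. S \<subseteq> X \<and> card S \<le> card K}"
    using assms card_shattered_by_halfspaces[OF assms(1), of _ \<phi> X] finite_subset[OF _ assms(2)]
    by (intro card_mono) auto
  finally show ?thesis using card_bounded_subsets[OF assms(2)] le_trans by blast
qed

section \<open>A Chernoff bound by counting\<close>

lemma one_minus_exp_ge:
  fixes x :: real
  assumes "0 \<le> x"
  shows "x - x\<^sup>2 / 2 \<le> 1 - exp (- x)"
proof -
  have "(\<lambda>x. 1 - exp (- x) - x + x\<^sup>2 / 2) 0 \<le> (\<lambda>x. 1 - exp (- x) - x + x\<^sup>2 / 2) x"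
  proof (rule DERIV_nonneg_imp_nondecreasing[OF assms])
    fix y :: real
    assume "0 \<le> y" "y \<le> x"
    have "DERIV (\<lambda>x. 1 - exp (- x) - x + x\<^sup>2 / 2) y :> exp (- y) - 1 + y"
      by (auto intro!: derivative_eq_intros)
    moreover have "0 \<le> exp (- y) - 1 + y" using exp_ge_add_one_self[of "- y"] by simp
    ultimately show "\<exists>z. DERIV (\<lambda>x. 1 - exp (- x) - x + x\<^sup>2 / 2) y :> z \<and> 0 \<le> z" by blast
  qed
  then show ?thesis by simp
qed

text \<open>
  A Chernoff bound for the lower tail, phrased as counting: if every coordinate of a uniformly
  random \<open>\<sigma>\<close> succeeds with probability at least \<open>q\<close>, independently, then at most \<open>t\<close> successes
  are exponentially unlikely.  Each \<open>\<sigma>\<close> is weighted by \<open>exp (- x)\<close> per success, and the total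
  weight factorises over the coordinates.
\<close>
lemma card_few_successes:
  fixes \<Omega> :: "'b set" and G :: "'i \<Rightarrow> 'b set" and q t :: real
  assumes I: "finite I" and \<Omega>: "finite \<Omega>"
    and G: "\<And>i. i \<in> I \<Longrightarrow> G i \<subseteq> \<Omega>"
    and hit: "\<And>i. i \<in> I \<Longrightarrow> q * card \<Omega> \<le> card (G i)"
    and t: "0 \<le> t" "t < q * card I"
  shows "card {\<sigma>\<in>PiE I (\<lambda>_. \<Omega>). card {i\<in>I. \<sigma> i \<in> G i} \<le> t}
    \<le> real (card \<Omega>) ^ card I * exp (- ((q * card I - t)\<^sup>2 / (2 * q * card I)))"
proof -
  define N where "N = real (card I)"
  \<comment> \<open>This \<open>x\<close> minimises the exponent \<open>x * t - q * N * (x - x\<^sup>2 / 2)\<close>.\<close>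
  define x where "x = (q * N - t) / (q * N)"
  have qN: "0 < q * N" using t by (simp add: N_def)
  have x: "0 \<le> x" using t qN by (simp add: x_def N_def)
  let ?E = "{\<sigma>\<in>PiE I (\<lambda>_. \<Omega>). card {i\<in>I. \<sigma> i \<in> G i} \<le> t}"
  let ?w = "\<lambda>i p. if p \<in> G i then exp (- x) else (1::real)"
  have fin: "finite (PiE I (\<lambda>_. \<Omega>))" using I \<Omega> by (intro finite_PiE)
  have "real (card ?E) * exp (- x * t) = (\<Sum>\<sigma>\<in>?E. exp (- x * t))" by simp
  also have "\<dots> \<le> (\<Sum>\<sigma>\<in>?E. \<Prod>i\<in>I. ?w i (\<sigma> i))"
  proof (rule sum_mono)
    fix \<sigma> assume \<sigma>: "\<sigma> \<in> ?E"
    have "(\<Prod>i\<in>I. ?w i (\<sigma> i)) = exp (- x) ^ card {i\<in>I. \<sigma> i \<in> G i}"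
      using I by (simp add: prod.If_cases Int_def)
    also have "\<dots> = exp (- x * card {i\<in>I. \<sigma> i \<in> G i})"
      by (simp add: exp_of_nat_mult[symmetric] mult.commute)
    also have "\<dots> \<ge> exp (- x * t)" using \<sigma> x by (simp add: mult_left_mono)
    finally show "exp (- x * t) \<le> (\<Prod>i\<in>I. ?w i (\<sigma> i))" .
  qed
  also have "\<dots> \<le> (\<Sum>\<sigma>\<in>PiE I (\<lambda>_. \<Omega>). \<Prod>i\<in>I. ?w i (\<sigma> i))"
    using fin by (intro sum_mono2) (auto intro: prod_nonneg)
  also have "\<dots> = (\<Prod>i\<in>I. \<Sum>p\<in>\<Omega>. ?w i p)"
    using I \<Omega> by (rule prod_sum_PiE[symmetric])
  also have "\<dots> \<le> (\<Prod>i\<in>I. real (card \<Omega>) * exp (- q * (1 - exp (- x))))"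
  proof (rule prod_mono)
    fix i assume i: "i \<in> I"
    have "(\<Sum>p\<in>\<Omega>. ?w i p) = (\<Sum>p\<in>\<Omega>. 1 - (if p \<in> G i then 1 - exp (- x) else 0))"
      by (intro sum.cong) auto
    also have "\<dots> = real (card \<Omega>) - card (G i) * (1 - exp (- x))"
      using \<Omega> G[OF i] by (simp add: sum_subtractf sum.If_cases Int_absorb1)
    also have "\<dots> \<le> real (card \<Omega>) - q * card \<Omega> * (1 - exp (- x))"
      using hit[OF i] x by (intro diff_left_mono mult_right_mono) auto
    also have "\<dots> = real (card \<Omega>) * (1 + - q * (1 - exp (- x)))" by (simp add: algebra_simps)
    also have "\<dots> \<le> real (card \<Omega>) * exp (- q * (1 - exp (- x)))"
      by (intro mult_left_mono exp_ge_add_one_self) auto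
    finally show "0 \<le> (\<Sum>p\<in>\<Omega>. ?w i p) \<and> (\<Sum>p\<in>\<Omega>. ?w i p) \<le> real (card \<Omega>) * exp (- q * (1 - exp (- x)))"
      by (auto intro: sum_nonneg)
  qed
  also have "\<dots> = real (card \<Omega>) ^ card I * exp (- (q * N) * (1 - exp (- x)))"
    by (simp add: power_mult_distrib exp_of_nat_mult[symmetric] N_def algebra_simps)
  also have "\<dots> \<le> real (card \<Omega>) ^ card I * exp (- (q * N) * (x - x\<^sup>2 / 2))"
  proof -
    have "q * N * (x - x\<^sup>2 / 2) \<le> q * N * (1 - exp (- x))"
      using one_minus_exp_ge[OF x] qN by (intro mult_left_mono) auto
    then show ?thesis by (intro mult_left_mono) auto
  qed
  finally have "real (card ?E) \<le> real (card \<Omega>) ^ card I * exp (- (q * N) * (x - x\<^sup>2 / 2)) / exp (- x * t)"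
    by (simp add: pos_le_divide_eq)
  also have "\<dots> = real (card \<Omega>) ^ card I * exp (- (q * N) * (x - x\<^sup>2 / 2) + x * t)"
    by (simp only: exp_add mult_minus_left exp_minus divide_inverse inverse_inverse_eq mult.assoc)
  also have "- (q * N) * (x - x\<^sup>2 / 2) + x * t = - ((q * N - t)\<^sup>2 / (2 * q * N))"
  proof -
    have "q * N * x = q * N - t" using qN unfolding x_def by (metis less_irrefl nonzero_mult_div_cancel_left times_divide_eq_right)
    then have t': "t = q * N - q * N * x" by simp
    have "- (q * N) * (x - x\<^sup>2 / 2) + x * t = - (q * N - t) * x / 2"
      unfolding t' by (simp add: power2_eq_square field_simps)
    also have "\<dots> = - ((q * N - t)\<^sup>2 / (2 * q * N))"
      by (simp add: x_def power2_eq_square mult_ac del: minus_diff_eq)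
    finally show ?thesis .
  qed
  finally show ?thesis by (simp add: N_def)
qed

section \<open>The number of color classes\<close>

text \<open>
  There are at most \<open>(N * r\<^sup>2 + 1) ^ (r * (d + 1))\<close> sign patterns, and a random choice is bad for
  a given one with probability at most the inverse of the right-hand side, so this inequality makes
  the union bound work.  Let \<open>y = q * N - t\<close> be the excess of the expected number of hits.  The exponent
  \<open>y\<^sup>2 / (2 * (y + t))\<close> has to beat a quantity of order \<open>r * d * (L + ln (y + t))\<close>, where \<open>L\<close> is the logarithm in
  the hypothesis.  For \<open>y \<le> t\<close> the exponent is of order \<open>y\<^sup>2 / t\<close>, and the term
  \<open>r * sqrt (t * d)\<close> is responsible; for \<open>y > t\<close> it is of order \<open>y\<close>, and the term \<open>r * d\<close> is.
\<close>
lemma union_bound_threshold: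
  fixes C :: real
  assumes C: "1 \<le> C"
  obtains K :: real where "0 < K"
    "\<And>(t::nat) (d::nat) (r::nat) (N::nat) (q::real). \<lbrakk>1 \<le> t; 1 \<le> d; 1 \<le> r; 1 / C \<le> q;
       t / q + K * (r * sqrt (real t * d) + real r * d) * ln (2 + real t + d + r) \<le> N\<rbrakk>
       \<Longrightarrow> t < q * N \<and>
          (real N * (real r)\<^sup>2 + 1) ^ (r * (d + 1)) < exp ((q * N - t)\<^sup>2 / (2 * q * N))"
proof -
  define a where "a = 6 + ln (4 * C)"
  \<comment> \<open>Large enough that \<open>8 * (a + ln k) < k\<close>, by the tangent bound
    \<open>ln (k / 16) \<le> k / 16 - 1\<close>.\<close>
  define k where "k = 16 * (a + ln 16) + 1"
  have lnC: "0 \<le> ln (4 * C)" using C by simp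
  have k1: "1 \<le> k" using lnC by (simp add: k_def a_def)
  have k: "8 * (a + ln k) < k"
  proof -
    have "ln (k / 16) \<le> k / 16 - 1" using k1 by (intro ln_le_minus_one) auto
    then have "ln k \<le> k / 16 - 1 + ln 16" using k1 by (simp add: ln_div)
    moreover have "k = 16 * a + 16 * ln 16 + 1" by (simp add: k_def)
    moreover have "8 * (a + x) < k" if "x \<le> k / 16 - 1 + y" "k = 16 * a + 16 * y + 1" for x y
      using that by (simp add: field_simps)
    ultimately show ?thesis by blast
  qed
  have goal: "t < q * N \<and>
      (real N * (real r)\<^sup>2 + 1) ^ (r * (d + 1)) < exp ((q * N - t)\<^sup>2 / (2 * q * N))"
    if t: "1 \<le> t" and d: "1 \<le> d" and r: "1 \<le> r" and q: "1 / C \<le> q"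
      and N: "t / q + k * C * (r * sqrt (real t * d) + real r * d) * ln (2 + real t + d + r) \<le> N"
    for t d r N :: nat and q :: real
  proof -
    define L where "L = ln (2 + real t + d + r)"
    define y where "y = q * N - t"
    define Y where "Y = k * (real r * d) * L"
    have "exp 1 \<le> 2 + real t + d + r" using exp_le t d r by linarith
    then have L1: "1 \<le> L" unfolding L_def using t by (subst ln_ge_iff) auto
    have lnL: "ln t \<le> L" "ln d \<le> L" "ln r \<le> L"
      unfolding L_def using t d r by (auto intro!: ln_mono)
    have lnLL: "ln L \<le> L" using ln_le_minus_one[of L] L1 by linarith
    have q0: "0 < q" and qC: "1 \<le> q * C"
      using q C by (auto simp: field_simps intro: less_le_trans[of 0 "1 / C"])
    have rd: "1 \<le> real r * d" using r d by (metis One_nat_def Suc_leI nat_0_less_mult_iff of_nat_1 of_nat_le_iff of_nat_mult zero_less_one less_le_trans)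
    have yN: "k * (r * sqrt (real t * d) + real r * d) * L \<le> y"
    proof -
      have "k * (r * sqrt (real t * d) + real r * d) * L * 1
          \<le> k * (r * sqrt (real t * d) + real r * d) * L * (q * C)"
        using k1 L1 qC by (intro mult_left_mono) auto
      also have "\<dots> = q * (t / q + k * C * (r * sqrt (real t * d) + real r * d) * L) - t"
        using q0 by (simp add: algebra_simps)
      also have "\<dots> \<le> y"
        unfolding y_def L_def using N q0 by (intro diff_right_mono mult_left_mono) auto
      finally show ?thesis by simp
    qed
    have Y: "Y \<le> y" "k * r * sqrt (real t * d) * L \<le> y"
    proof -
      have "0 \<le> k * (real r * sqrt (real t * d)) * L" "0 \<le> k * (real r * d) * L" using k1 L1 by auto
      then show "Y \<le> y" "k * r * sqrt (real t * d) * L \<le> y"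
        using yN by (auto simp: Y_def algebra_simps)
    qed
    have Y0: "0 < Y" using k1 L1 rd by (simp add: Y_def)
    then have y0: "0 < y" using Y by linarith
    have qN: "q * N = y + t" by (simp add: y_def)
    have N0: "0 < N" using qN y0 q0 by (metis add_pos_nonneg mult_zero_right of_nat_0 of_nat_0_le_iff less_irrefl neq0_conv)
    define W where "W = ln (real N * (real r)\<^sup>2 + 1)"
    have "real N \<le> C * (y + t)"
    proof -
      have "1 * real N \<le> (q * C) * N" using qC by (intro mult_right_mono) auto
      then show ?thesis by (simp add: qN[symmetric] mult_ac)
    qed
    then have "real N * (real r)\<^sup>2 \<le> C * (y + t) * (real r)\<^sup>2" by (intro mult_right_mono) auto
    moreover have "1 \<le> C * (y + t) * (real r)\<^sup>2"
    proof -
      have "1 * 1 * 1 \<le> C * (y + t) * (real r)\<^sup>2"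
        using C y0 t r by (intro mult_mono) auto
      then show ?thesis by simp
    qed
    ultimately have "real N * (real r)\<^sup>2 + 1 \<le> 2 * C * (y + t) * (real r)\<^sup>2" by simp
    then have "W \<le> ln (2 * C * (y + t) * (real r)\<^sup>2)"
      unfolding W_def by (intro ln_mono) (auto intro: add_nonneg_pos)
    also have "\<dots> = ln (2 * C) + ln (y + t) + 2 * ln r"
      using C y0 r by (simp add: ln_mult ln_realpow)
    finally have W1: "W \<le> ln (2 * C) + ln (y + t) + 2 * L" using lnL by linarith
    have ln4: "ln (4 * C) = ln (2 * C) + ln 2"
      using C ln_mult[of "2 * C" 2] by simp
    have W0: "0 \<le> W" by (simp add: W_def)
    have dim: "real (r * (d + 1)) \<le> 2 * (real r * d)"
    proof -
      have "r * (d + 1) \<le> r * (2 * d)" using d by (intro mult_le_mono) auto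
      then have "real (r * (d + 1)) \<le> real (r * (2 * d))" by (simp only: of_nat_le_iff)
      then show ?thesis by simp
    qed
    have "r * (d + 1) * W < y\<^sup>2 / (2 * (y + t))"
    proof (cases "y \<le> t")
      case True
      have "ln (y + t) \<le> ln (2 * real t)" using y0 True by (intro ln_mono) auto
      then have "ln (y + t) \<le> ln 2 + L" using lnL(1) t by (simp add: ln_mult)
      then have "W \<le> ln (4 * C) + 3 * L" using W1 ln4 by linarith
      also have "\<dots> \<le> ln (4 * C) * L + 3 * L" using mult_left_mono[OF L1 lnC] by simp
      also have "\<dots> \<le> a * L" using L1 by (simp add: a_def algebra_simps)
      finally have "r * (d + 1) * W \<le> (2 * (real r * d)) * (a * L)"
        using dim W0 by (intro mult_mono) auto
      also have "\<dots> = 8 * a * (real r * d * L / 4)" by simp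
      also have "\<dots> < k * (real r * d * L / 4)"
      proof (rule mult_strict_right_mono)
        show "8 * a < k" using k k1 by (smt (verit) ln_ge_zero)
      qed (use rd L1 in auto)
      also have "\<dots> \<le> k\<^sup>2 * (real r * d * L / 4) * (r * L)"
      proof -
        have "1 * 1 \<le> r * L" using r L1 by (intro mult_mono) auto
        then have "k * (real r * d * L / 4) * 1 \<le> k\<^sup>2 * (real r * d * L / 4) * (r * L)"
          using k1 L1 self_le_power[of k 2] by (intro mult_mono) auto
        then show ?thesis by simp
      qed
      also have "\<dots> = (k * r * sqrt (real t * d) * L)\<^sup>2 / (4 * t)"
        using t by (simp add: power_mult_distrib) (simp add: power2_eq_square)
      also have "\<dots> \<le> y\<^sup>2 / (4 * t)"
        using Y(2) k1 L1 by (intro divide_right_mono power_mono) auto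
      also have "\<dots> \<le> y\<^sup>2 / (2 * (y + t))"
        using True y0 t by (intro divide_left_mono) auto
      finally show ?thesis .
    next
      case False
      have "ln (y + t) \<le> ln (2 * y)" using y0 False by (intro ln_mono) auto
      also have "\<dots> = ln 2 + ln (y / Y) + ln Y" using y0 Y0 by (simp add: ln_mult ln_div)
      \<comment> \<open>\<open>N\<close> is not bounded above, so the logarithm of \<open>y\<close> is charged to \<open>y\<close> itself, relative to
        its least possible value \<open>Y\<close>.\<close>
      also have "\<dots> \<le> ln 2 + y / Y + ln Y" using ln_le_minus_one[of "y / Y"] y0 Y0 by simp
      also have "ln Y = ln k + ln r + ln d + ln L"
        using k1 L1 r d by (simp add: Y_def ln_mult)
      finally have "W \<le> y / Y + (ln (4 * C) + ln k + 5 * L)" using W1 ln4 lnL lnLL by linarith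
      also have "ln (4 * C) + ln k \<le> (ln (4 * C) + ln k) * L"
        using mult_left_mono[OF L1, of "ln (4 * C) + ln k"] lnC k1 by simp
      finally have "W \<le> y / Y + (a - 1 + ln k) * L" by (simp add: a_def algebra_simps)
      then have "r * (d + 1) * W \<le> (2 * (real r * d)) * (y / Y + (a - 1 + ln k) * L)"
        using dim W0 by (intro mult_mono) auto
      also have "\<dots> = 2 / k * (y / L + (a - 1 + ln k) * Y)"
        using k1 L1 r d by (simp add: Y_def field_simps)
      also have "\<dots> \<le> 2 / k * (y + (a - 1 + ln k) * y)"
        using k1 L1 y0 Y lnC by (intro mult_left_mono add_mono) (auto simp: a_def divide_le_eq_1 field_simps)
      also have "\<dots> = 2 * (a + ln k) / k * y" by (simp add: field_simps)
      also have "\<dots> < 1 / 4 * y"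
        using k k1 y0 by (intro mult_strict_right_mono) (auto simp: field_simps)
      also have "\<dots> = y\<^sup>2 / (2 * (y + y))" using y0 by (simp add: power2_eq_square)
      also have "\<dots> \<le> y\<^sup>2 / (2 * (y + t))"
        using False y0 by (intro divide_left_mono) auto
      finally show ?thesis .
    qed
    then have "exp (r * (d + 1) * W) < exp ((q * N - t)\<^sup>2 / (2 * q * N))"
      by (simp add: qN mult.assoc)
    moreover have "exp (r * (d + 1) * W) = (real N * (real r)\<^sup>2 + 1) ^ (r * (d + 1))"
    proof -
      have "exp (r * (d + 1) * W) = exp W ^ (r * (d + 1))" by (rule exp_of_nat_mult)
      also have "exp W = real N * (real r)\<^sup>2 + 1" unfolding W_def by (intro exp_ln) (auto intro: add_nonneg_pos)
      finally show ?thesis .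
    qed
    moreover have "t < q * N" using y0 y_def by simp
    ultimately show ?thesis by argo
  qed
  show ?thesis using that[of "k * C"] goal k1 C by auto
qed

section \<open>Tolerant colorful partitions\<close>

definition parts :: "nat \<Rightarrow> nat \<Rightarrow> (nat \<Rightarrow> nat \<Rightarrow> nat) \<Rightarrow> nat \<Rightarrow> (nat \<times> nat) set"
  where "parts N r \<sigma> k = {(i, j). i < N \<and> j < r \<and> \<sigma> i j = k}"

lemma colorful_partition_parts:
  assumes perm: "\<And>i. i < N \<Longrightarrow> \<sigma> i permutes {..<r}"
  shows "colorful_partition N r (parts N r \<sigma>)"
  unfolding colorful_partition_def
proof (intro conjI allI impI)
  show "disjoint_family_on (parts N r \<sigma>) {..<r}"
    by (auto simp: disjoint_family_on_def parts_def)
  have "\<sigma> i j < r" if "i < N" "j < r" for i j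
    using permutes_in_image[OF perm[OF that(1)], of j] that by simp
  then show "(\<Union>k<r. parts N r \<sigma> k) = (\<Union>i<N. color_class r i)"
    by (auto simp: parts_def color_class_def)
  fix k i assume k: "k < r" and i: "i < N"
  have "parts N r \<sigma> k \<inter> color_class r i = {(i, inv (\<sigma> i) k)}"
    using permutes_inverses[OF perm[OF i]] permutes_in_image[OF permutes_inv[OF perm[OF i]], of k] i k
    by (auto simp: parts_def color_class_def)
  then show "card (parts N r \<sigma> k \<inter> color_class r i) = 1" by simp
qed

lemma remaining_points_parts:
  "remaining_points P r T (parts N r \<sigma> k) = {P i j |i j. i < N \<and> i \<notin> T \<and> j < r \<and> \<sigma> i j = k}"
proof -
  have "parts N r \<sigma> k - (\<Union>i\<in>T. color_class r i) = {(i, j). i < N \<and> i \<notin> T \<and> j < r \<and> \<sigma> i j = k}"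
    unfolding parts_def color_class_def by blast
  then show ?thesis unfolding remaining_points_def by auto
qed

text \<open>
  Features under which a tuple of \<open>r\<close> affine functionals on \<open>d\<close>-space becomes one linear
  functional: the label \<open>(i, j, k)\<close> stands for the homogeneous vector of the point \<open>P i j\<close>, put in
  the \<open>k\<close>-th of \<open>r\<close> blocks.  Coordinate \<open>d\<close> of a block is the homogenising one.
\<close>
definition sarkaria_tensor ::
    "nat \<Rightarrow> (nat \<Rightarrow> nat \<Rightarrow> (nat \<Rightarrow>\<^sub>0 real)) \<Rightarrow> nat \<times> nat \<times> nat \<Rightarrow> nat \<times> nat \<Rightarrow> real"
  where "sarkaria_tensor d P = (\<lambda>(i, j, k) (l, c).
    if l = k then (if c < d then Poly_Mapping.lookup (P i j) c else 1) else 0)"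

lemma sarkaria_tensor_pairing:
  assumes "k < r"
  shows "(\<Sum>x\<in>{..<r} \<times> {..d}. u x * sarkaria_tensor d P (i, j, k) x)
    = (\<Sum>c<d. u (k, c) * Poly_Mapping.lookup (P i j) c) + u (k, d)"
proof -
  have "(\<Sum>x\<in>{..<r} \<times> {..d}. u x * sarkaria_tensor d P (i, j, k) x)
    = (\<Sum>l<r. if l = k then (\<Sum>c\<le>d. u (k, c) * (if c < d then Poly_Mapping.lookup (P i j) c else 1)) else 0)"
    unfolding sum.cartesian_product'
    by (intro sum.cong refl) (simp add: sarkaria_tensor_def)
  also have "\<dots> = (\<Sum>c\<le>d. u (k, c) * (if c < d then Poly_Mapping.lookup (P i j) c else 1))"
    using assms by simp
  also have "\<dots> = (\<Sum>c<d. u (k, c) * (if c < d then Poly_Mapping.lookup (P i j) c else 1)) + u (k, d)"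
    by (simp add: lessThan_Suc_atMost[symmetric])
  finally show ?thesis by simp
qed

lemma lookup_eq_0_outside: "x \<in> Rn d \<Longrightarrow> d \<le> c \<Longrightarrow> Poly_Mapping.lookup x c = 0"
  by (force simp: Rn_def in_keys_iff)

text \<open>
  The separating functionals, with their coefficients collected in one vector: this is what makes
  \<open>\<sigma>\<close> visible to sign patterns.
\<close>
lemma separated_parts:
  assumes P: "\<And>i j. i < N \<Longrightarrow> j < r \<Longrightarrow> P i j \<in> Rn d"
    and perm: "\<And>i. i < N \<Longrightarrow> \<sigma> i permutes {..<r}"
    and empty: "(\<Inter>k<r. convex hull (remaining_points P r T (parts N r \<sigma> k))) = {}"
  obtains u :: "nat \<times> nat \<Rightarrow> real"
  where "\<And>c. (\<Sum>k<r. u (k, c)) = 0"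
    "\<And>i j. i < N \<Longrightarrow> i \<notin> T \<Longrightarrow> j < r \<Longrightarrow>
      0 < (\<Sum>x\<in>{..<r} \<times> {..d}. u x * sarkaria_tensor d P (i, j, \<sigma> i j) x)"
proof -
  let ?B = "\<lambda>k. remaining_points P r T (parts N r \<sigma> k)"
  have fin: "finite (?B k)" for k
  proof -
    have "parts N r \<sigma> k \<subseteq> {..<N} \<times> {..<r}" by (auto simp: parts_def)
    then have "finite (parts N r \<sigma> k)" by (rule finite_subset) simp
    then show ?thesis unfolding remaining_points_def by simp
  qed
  have "?B k \<subseteq> Rn d" for k using P by (auto simp: remaining_points_parts)
  then have hull: "convex hull (?B k) \<subseteq> Rn d" for k by (simp add: hull_minimal convex_Rn)
  have inj: "x = y" if xy: "x \<in> convex hull (?B k)" "y \<in> convex hull (?B l)"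
      "\<And>c. c \<in> {..<d} \<Longrightarrow> Poly_Mapping.lookup x c = Poly_Mapping.lookup y c" for x y k l
  proof (rule poly_mapping_eqI)
    fix c
    have "x \<in> Rn d" "y \<in> Rn d" using subsetD[OF hull xy(1)] subsetD[OF hull xy(2)] .
    then show "Poly_Mapping.lookup x c = Poly_Mapping.lookup y c"
      using xy(3)[of c] by (cases "c < d") (simp_all add: lookup_eq_0_outside)
  qed
  obtain a :: "nat \<Rightarrow> nat \<Rightarrow> real" and b :: "nat \<Rightarrow> real"
    where ab: "\<And>c. (\<Sum>k<r. a k c) = 0" "(\<Sum>k<r. b k) = 0"
      "\<And>k x. k \<in> {..<r} \<Longrightarrow> x \<in> ?B k \<Longrightarrow> 0 < (\<Sum>c<d. a k c * Poly_Mapping.lookup x c) + b k"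
  proof (rule separating_affine_functionals[of "{..<d}" "{..<r}" ?B "\<lambda>c x. Poly_Mapping.lookup x c"])
    show "x = y" if "x \<in> convex hull (?B k)" "y \<in> convex hull (?B l)"
      "\<And>c. c \<in> {..<d} \<Longrightarrow> Poly_Mapping.lookup x c = Poly_Mapping.lookup y c" for x y k l
      by (rule inj[OF that])
    fix a :: "nat \<Rightarrow> nat \<Rightarrow> real" and b :: "nat \<Rightarrow> real"
    assume "\<And>c. (\<Sum>k<r. a k c) = 0" "(\<Sum>k<r. b k) = 0"
      "\<And>k x. k \<in> {..<r} \<Longrightarrow> x \<in> ?B k \<Longrightarrow> 0 < (\<Sum>c<d. a k c * Poly_Mapping.lookup x c) + b k"
    then show thesis by (rule that)
  qed (use fin bounded_linear_lookup empty in simp_all)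
  define u where "u = (\<lambda>(k, c). if c = d then b k else a k c)"
  have "(\<Sum>k<r. u (k, c)) = 0" for c using ab(1)[of c] ab(2) by (cases "c = d") (simp_all add: u_def)
  moreover have "0 < (\<Sum>x\<in>{..<r} \<times> {..d}. u x * sarkaria_tensor d P (i, j, \<sigma> i j) x)"
    if "i < N" "i \<notin> T" "j < r" for i j
  proof -
    have k: "\<sigma> i j < r" using permutes_in_image[OF perm[OF that(1)], of j] that by simp
    have "P i j \<in> ?B (\<sigma> i j)" using that by (auto simp: remaining_points_parts)
    then have "0 < (\<Sum>c<d. a (\<sigma> i j) c * Poly_Mapping.lookup (P i j) c) + b (\<sigma> i j)"
      using ab(3)[of "\<sigma> i j"] k by blast
    then show ?thesis unfolding sarkaria_tensor_pairing[OF k] by (simp add: u_def)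
  qed
  ultimately show ?thesis using that[of u] by blast
qed

text \<open>
  Choosing one failing \<open>k\<close> for every \<open>j\<close> gives a map \<open>f\<close>, and a permutation that does not avoid
  \<open>f\<close> has the required property.
\<close>
lemma card_hitting_permutations:
  assumes S: "\<And>j. j < r \<Longrightarrow> \<exists>k<r. \<not> R j k"
  shows "hit_probability r * card {p. p permutes {..<r}}
    \<le> card {p. p permutes {..<r} \<and> (\<exists>j<r. \<not> R j (p j))}"
proof -
  obtain f where f: "\<And>j. j < r \<Longrightarrow> f j < r \<and> \<not> R j (f j)" using S by metis
  let ?\<Omega> = "{p. p permutes {..<r}}"
  have finO: "finite ?\<Omega>" by (simp add: finite_permutations)
  have "card (avoiding {..<r} f) \<le> card (derangements {..<r})"
    using f by (intro card_avoiding_le_derangements) auto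
  moreover have "card ?\<Omega> = fact r" by (simp add: card_permutations)
  moreover have "card ?\<Omega> \<le> card (avoiding {..<r} f) + card {p. p permutes {..<r} \<and> (\<exists>j<r. \<not> R j (p j))}"
  proof -
    have "?\<Omega> \<subseteq> avoiding {..<r} f \<union> {p. p permutes {..<r} \<and> (\<exists>j<r. \<not> R j (p j))}"
      using f by (fastforce simp: avoiding_def)
    then have "card ?\<Omega> \<le> card (avoiding {..<r} f \<union> {p. p permutes {..<r} \<and> (\<exists>j<r. \<not> R j (p j))})"
      using finO by (intro card_mono) (auto simp: finite_avoiding)
    then show ?thesis using card_Un_le le_trans by blast
  qed
  ultimately have "real (fact r) \<le> real (card (derangements {..<r})
      + card {p. p permutes {..<r} \<and> (\<exists>j<r. \<not> R j (p j))})"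
    by (simp only: of_nat_le_iff)
  moreover have "hit_probability r * fact r = fact r - real (card (derangements {..<r}))"
    by (simp add: hit_probability_def left_diff_distrib)
  moreover have "real (card ?\<Omega>) = fact r" by (simp add: card_permutations)
  ultimately show ?thesis by simp
qed

text \<open>
  The probabilistic argument.  A choice \<open>\<sigma>\<close> is bad for a sign pattern \<open>S\<close> if at most \<open>t\<close> classes
  contain a point whose label \<open>(i, j, \<sigma> i j)\<close> lies outside \<open>S\<close>; if removing \<open>t\<close>
  classes leaves the hulls without a common point, \<open>\<sigma>\<close> is bad for the pattern of the separating
  vector.  Fewer than \<open>fact r ^ N\<close> choices are bad for some pattern.
\<close>
lemma exists_tolerant_permutations:
  fixes P :: "nat \<Rightarrow> nat \<Rightarrow> (nat \<Rightarrow>\<^sub>0 real)" and N r d t :: nat and q :: real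
  defines "q \<equiv> hit_probability r"
  assumes r: "1 \<le> r" and P: "\<And>i j. i < N \<Longrightarrow> j < r \<Longrightarrow> P i j \<in> Rn d"
    and t: "t < q * N"
    and few: "(real N * (real r)\<^sup>2 + 1) ^ (r * (d + 1)) < exp ((q * N - t)\<^sup>2 / (2 * q * N))"
  obtains \<sigma> where "\<And>i. i < N \<Longrightarrow> \<sigma> i permutes {..<r}"
    "\<And>T. T \<subseteq> {..<N} \<Longrightarrow> card T = t \<Longrightarrow>
      (\<Inter>k<r. convex hull (remaining_points P r T (parts N r \<sigma> k))) \<noteq> {}"
proof -
  let ?\<Omega> = "{p. p permutes {..<r}}" and ?K = "{..<r} \<times> {..d}"
  let ?X = "{..<N} \<times> {..<r} \<times> {..<r}" and ?\<phi> = "sarkaria_tensor d P"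
  define balanced where "balanced = {u :: nat \<times> nat \<Rightarrow> real. \<forall>c. (\<Sum>k<r. u (k, c)) = 0}"
  define F where "F = positive_part ?K ?\<phi> ?X ` balanced"
  define G where "G S i = {p. p permutes {..<r} \<and> (\<exists>j<r. (i, j, p j) \<notin> S)}" for S :: "(nat \<times> nat \<times> nat) set" and i
  define Bad where "Bad S = {\<sigma>\<in>PiE {..<N} (\<lambda>_. ?\<Omega>). card {i\<in>{..<N}. \<sigma> i \<in> G S i} \<le> real t}" for S
  define E where "E = exp ((q * N - t)\<^sup>2 / (2 * q * N))"
  have finO: "finite ?\<Omega>" by (simp add: finite_permutations)
  have cardO: "card ?\<Omega> = fact r" by (simp add: card_permutations)
  have finR: "finite (range (positive_part ?K ?\<phi> ?X))"
    by (rule finite_subset[of _ "Pow ?X"]) (auto simp: positive_part_def)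
  then have finF: "finite F" unfolding F_def by (rule finite_subset[rotated]) blast
  have cardF: "real (card F) < E"
  proof -
    have "card F \<le> card (range (positive_part ?K ?\<phi> ?X))"
      unfolding F_def by (intro card_mono finR image_mono) simp
    also have "\<dots> \<le> (card ?X + 1) ^ card ?K" by (intro card_halfspace_patterns) auto
    finally have "real (card F) \<le> real ((card ?X + 1) ^ card ?K)" by (simp only: of_nat_le_iff)
    also have "\<dots> = (real N * (real r)\<^sup>2 + 1) ^ (r * (d + 1))"
      by (simp add: card_cartesian_product power2_eq_square add.commute)
    finally show ?thesis using few by (simp add: E_def)
  qed
  have cardBad: "real (card (Bad S)) \<le> fact r ^ N / E" if SF: "S \<in> F" for S
  proof -
    obtain u where u: "u \<in> balanced" and S: "S = positive_part ?K ?\<phi> ?X u"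
      using SF by (auto simp: F_def)
    \<comment> \<open>The blocks of \<open>u\<close> sum to zero, so the \<open>r\<close> functionals cannot all be positive at one point.\<close>
    have "\<exists>k<r. (i, j, k) \<notin> S" if ij: "i < N" "j < r" for i j
    proof (rule ccontr)
      assume "\<not> ?thesis"
      then have pos: "0 < (\<Sum>c<d. u (k, c) * Poly_Mapping.lookup (P i j) c) + u (k, d)" if "k < r" for k
        using that sarkaria_tensor_pairing[OF that, of u d P i j] by (auto simp: S positive_part_def)
      have "0 < (\<Sum>k<r. (\<Sum>c<d. u (k, c) * Poly_Mapping.lookup (P i j) c) + u (k, d))"
        using r pos by (intro sum_pos) (auto simp: lessThan_empty_iff)
      also have "\<dots> = (\<Sum>c<d. (\<Sum>k<r. u (k, c)) * Poly_Mapping.lookup (P i j) c) + (\<Sum>k<r. u (k, d))"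
        by (simp add: sum.distrib sum_distrib_right) (rule sum.swap)
      also have "\<dots> = 0" using u by (simp add: balanced_def)
      finally show False by simp
    qed
    then have hit: "q * card ?\<Omega> \<le> card (G S i)" if "i < N" for i
      unfolding G_def q_def using card_hitting_permutations[of r "\<lambda>j k. (i, j, k) \<in> S"] that by blast
    have "card (Bad S) \<le> real (card ?\<Omega>) ^ card {..<N}
        * exp (- ((q * card {..<N} - t)\<^sup>2 / (2 * q * card {..<N})))"
      unfolding Bad_def
    proof (rule card_few_successes)
      show "G S i \<subseteq> ?\<Omega>" for i by (auto simp: G_def)
      show "q * card ?\<Omega> \<le> card (G S i)" if "i \<in> {..<N}" for i using hit that by blast
      show "real t < q * card {..<N}" using t by simp
    qed (use finO in simp_all)
    also have "\<dots> = fact r ^ N / E" by (simp only: cardO card_lessThan E_def exp_minus divide_inverse of_nat_fact)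
    finally show ?thesis .
  qed
  have "real (card (\<Union>S\<in>F. Bad S)) \<le> (\<Sum>S\<in>F. real (card (Bad S)))"
    using card_UN_le[OF finF, of Bad] by (simp only: of_nat_le_iff flip: of_nat_sum)
  also have "\<dots> \<le> real (card F) * (fact r ^ N / E)"
    using cardBad sum_bounded_above[of F "\<lambda>S. real (card (Bad S))" "fact r ^ N / E"] by simp
  also have "\<dots> < E * (fact r ^ N / E)"
    using cardF by (intro mult_strict_right_mono) (auto simp: E_def)
  also have "\<dots> = real (card (PiE {..<N} (\<lambda>_. ?\<Omega>)))"
    by (simp add: E_def card_PiE cardO)
  finally have "card (\<Union>S\<in>F. Bad S) < card (PiE {..<N} (\<lambda>_. ?\<Omega>))" by simp
  then have "\<not> PiE {..<N} (\<lambda>_. ?\<Omega>) \<subseteq> (\<Union>S\<in>F. Bad S)"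
  proof -
    have "finite (\<Union>S\<in>F. Bad S)"
      by (rule finite_subset[of _ "PiE {..<N} (\<lambda>_. ?\<Omega>)"]) (auto simp: Bad_def finO intro!: finite_PiE)
    then show ?thesis using \<open>card _ < card _\<close> card_mono not_less by blast
  qed
  then obtain \<sigma> where \<sigma>: "\<sigma> \<in> PiE {..<N} (\<lambda>_. ?\<Omega>)" and good: "\<And>S. S \<in> F \<Longrightarrow> \<sigma> \<notin> Bad S" by blast
  have perm: "\<sigma> i permutes {..<r}" if "i < N" for i using PiE_mem[OF \<sigma>, of i] that by simp
  have tolerant: "(\<Inter>k<r. convex hull (remaining_points P r T (parts N r \<sigma> k))) \<noteq> {}"
    if T: "T \<subseteq> {..<N}" "card T = t" for T
  proof
    assume empty: "(\<Inter>k<r. convex hull (remaining_points P r T (parts N r \<sigma> k))) = {}"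
    obtain u where u: "\<And>c. (\<Sum>k<r. u (k, c)) = 0"
      "\<And>i j. i < N \<Longrightarrow> i \<notin> T \<Longrightarrow> j < r \<Longrightarrow> 0 < (\<Sum>x\<in>?K. u x * ?\<phi> (i, j, \<sigma> i j) x)"
      using separated_parts[OF P perm empty] by blast
    let ?S = "positive_part ?K ?\<phi> ?X u"
    have "?S \<in> F" using u(1) by (auto simp: F_def balanced_def)
    have "{i\<in>{..<N}. \<sigma> i \<in> G ?S i} \<subseteq> T"
    proof (rule ccontr)
      assume "\<not> ?thesis"
      then obtain i j where ij: "i < N" "i \<notin> T" "j < r" "(i, j, \<sigma> i j) \<notin> ?S" by (auto simp: G_def)
      moreover have "\<sigma> i j < r" using permutes_in_image[OF perm[OF ij(1)], of j] ij by simp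
      ultimately show False using u(2)[OF ij(1-3)] by (simp add: positive_part_def)
    qed
    then have "card {i\<in>{..<N}. \<sigma> i \<in> G ?S i} \<le> t"
      using T card_mono finite_subset[OF T(1)] by blast
    then have "\<sigma> \<in> Bad ?S" using \<sigma> by (simp add: Bad_def)
    then show False using good[OF \<open>?S \<in> F\<close>] by blast
  qed
  show ?thesis by (rule that[OF perm tolerant])
qed

theorem theorem4p2:
  shows "\<exists>(c :: nat \<Rightarrow> real) (K :: real) (m :: real).
    c \<longlonglongrightarrow> exp 1 / (exp 1 - 1) \<and> K > 0 \<and> m > 0 \<and>
    (\<forall>(t :: nat) (d :: nat) (r :: nat) (N :: nat) (P :: nat \<Rightarrow> nat \<Rightarrow> (nat \<Rightarrow>\<^sub>0 real)).
      t \<ge> 1 \<longrightarrow> d \<ge> 1 \<longrightarrow> r \<ge> 1 \<longrightarrow>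
      real N \<ge> c r * real t
        + K * (real r * sqrt (real t * real d) + real r * real d)
            * ln (2 + real t + real d + real r) powr m \<longrightarrow>
      (\<forall>i<N. \<forall>j<r. P i j \<in> Rn d) \<longrightarrow>
      (\<exists>A. colorful_partition N r A \<and>
        (\<forall>T. T \<subseteq> {..<N} \<and> card T = t \<longrightarrow>
          (\<Inter>k<r. convex hull (remaining_points P r T (A k))) \<noteq> {})))"
proof -
  define c where "c r = 1 / hit_probability r" for r
  have "1 - exp (- 1) \<noteq> (0::real)" by simp
  then have "c \<longlonglongrightarrow> 1 / (1 - exp (- 1))"
    unfolding c_def by (intro tendsto_intros hit_probability_tendsto)
  moreover have "1 / (1 - exp (- 1)) = exp 1 / (exp 1 - (1::real))"
    by (simp add: exp_minus field_simps)
  ultimately have c: "c \<longlonglongrightarrow> exp 1 / (exp 1 - 1)" by simp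
  then have "Bseq c" by (intro convergent_imp_Bseq) (auto simp: convergent_def)
  then obtain C0 where "\<And>r. norm (c r) \<le> C0" by (auto simp: Bseq_def)
  then have C: "c r \<le> max 1 C0" for r by (smt (verit) real_norm_def)
  have q: "1 / max 1 C0 \<le> hit_probability r" if "1 \<le> r" for r
    using C[of r] hit_probability_pos[OF that] by (simp add: c_def field_simps)
  obtain K where "0 < K" and K:
    "\<And>(t::nat) (d::nat) (r::nat) (N::nat) (q::real). \<lbrakk>1 \<le> t; 1 \<le> d; 1 \<le> r; 1 / max 1 C0 \<le> q;
       t / q + K * (r * sqrt (real t * d) + real r * d) * ln (2 + real t + d + r) \<le> N\<rbrakk>
       \<Longrightarrow> t < q * N \<and>
          (real N * (real r)\<^sup>2 + 1) ^ (r * (d + 1)) < exp ((q * N - t)\<^sup>2 / (2 * q * N))"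
    using union_bound_threshold[of "max 1 C0"] by (metis max.cobounded1)
  \<comment> \<open>The first power of the logarithm suffices, hence the exponent \<open>1\<close>.\<close>
  have "\<exists>A. colorful_partition N r A \<and>
      (\<forall>T. T \<subseteq> {..<N} \<and> card T = t \<longrightarrow> (\<Inter>k<r. convex hull (remaining_points P r T (A k))) \<noteq> {})"
    if t: "t \<ge> 1" and d: "d \<ge> 1" and r: "r \<ge> 1"
      and N: "real N \<ge> c r * real t + K * (real r * sqrt (real t * real d) + real r * real d)
            * ln (2 + real t + real d + real r) powr 1"
      and P: "\<forall>i<N. \<forall>j<r. P i j \<in> Rn d"
    for t d r N and P :: "nat \<Rightarrow> nat \<Rightarrow> (nat \<Rightarrow>\<^sub>0 real)"
  proof -
    have "0 < ln (2 + real t + real d + real r)" by simp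
    then have "t / hit_probability r + K * (r * sqrt (real t * d) + real r * d) * ln (2 + real t + d + r) \<le> N"
      using N by (simp add: c_def)
    note thr = K[OF t d r q[OF r] this]
    obtain \<sigma> where perm: "\<And>i. i < N \<Longrightarrow> \<sigma> i permutes {..<r}"
      and tol: "\<And>T. T \<subseteq> {..<N} \<Longrightarrow> card T = t \<Longrightarrow>
        (\<Inter>k<r. convex hull (remaining_points P r T (parts N r \<sigma> k))) \<noteq> {}"
      using exists_tolerant_permutations[OF r _ conjunct1[OF thr] conjunct2[OF thr], of P] P by blast
    show ?thesis
      by (rule exI[of _ "parts N r \<sigma>"]) (simp add: colorful_partition_parts[OF perm] tol)
  qed
  note tolerant = this
  show ?thesis
    by (rule exI[of _ c], rule exI[of _ K], rule exI[of _ 1], intro conjI allI impI)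
      (fact c, fact \<open>0 < K\<close>, rule zero_less_one, rule tolerant)
qed

end
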